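(* Let $\omega_1,\omega_2,\dots,\omega_n\in\overline{\mathcal{H}}_3=\mathcal{H}_3\cup\mathbb{C}\mathbb{P}^1$. The hyperbolic convex hull of $\omega_1,\dots,\omega_n$ parametrizes the Hermitian forms $\sum_{i=1}^n\lambda_iH_{\omega_i}$ with $\lambda_i\ge 0$ for $i=1,\dots,n$ and $\sum_{i=1}^n\lambda_i=1$; that is, the set of zeros $\xi\left(\sum_{i=1}^n\lambda_iH_{\omega_i}\right)$ of all such forms is exactly the hyperbolic convex hull of $\omega_1,\dots,\omega_n$.
   Context: $\mathcal{H}_3=\mathbb{C}\times\mathbb{R}^+$ is the upper half-space model of hyperbolic 3-space, with points written $z+t\mathbf{j}$ ($z\in\mathbb{C}$, $t>0$), metric $ds^2=(|dz|^2+dt^2)/t^2$, and boundary $\partial\mathcal{H}_3=\mathbb{C}\mathbb{P}^1=\mathbb{C}\cup\{\infty\}$. Convex hulls are taken in $\overline{\mathcal{H}}_3$: the hyperbolic convex hull of a finite set is the smallest subset of $\overline{\mathcal{H}}_3$ containing it and containing, with any two of its points, the hyperbolic segment joining them (the closed arc of the hyperbolic geodesic between them, ideal endpoints included). A Hermitian form $H(X,Z)=a|X|^2-bX\bar Z-\bar b\bar XZ+c|Z|^2$ with $a,c\in\mathbb{R}$, $b\in\mathbb{C}$ has discriminant $\Delta=ac-|b|^2$ and is called positive definite if $\Delta>0$ and $a>0$; its zero is $\xi(H)=\frac{\bar b}{a}+\mathbf{j}\frac{\sqrt{\Delta}}{a}\in\mathcal{H}_3$. For $\omega=z+t\mathbf{j}\in\mathcal{H}_3$,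 $H_\omega=|X|^2-\bar zX\bar Z-z\bar XZ+(|z|^2+t^2)|Z|^2$ (the positive definite form with leading coefficient $1$ and zero $\omega$); for $\beta\in\mathbb{C}$, $H_\beta=(X-\beta Z)(\bar X-\bar\beta\bar Z)=|X-\beta Z|^2$; and $H_\infty=|Z|^2$. For forms that are positive multiples of $H_\beta$ ($\beta\in\mathbb{C}$) or of $H_\infty$ (the case $\Delta=0$), the zero is $\beta$, respectively $\infty$, in the boundary. Thus a form is represented by $\omega\in\overline{\mathcal{H}}_3$ if and only if it is a positive multiple of $H_\omega$. *)

theory Defs
  imports "HOL-Analysis.Analysis"
begin

text \<open>
  \<^term>\<open>H3\<close> is the open upper half-space, as a subset of the Euclidean space
  \<^typ>\<open>complex \<times> real\<close>.  The datatype adds the points of the complex projective line; its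
  constructor \<open>Point\<close> is only meaningful with positive second argument, whence the carrier
  \<open>closed_H3\<close>.
\<close>

definition H3 :: "(complex \<times> real) set" where
  "H3 = {x. snd x > 0}"

datatype hpoint = Point complex real | Ideal complex | Infty

definition closed_H3 :: "hpoint set" where
  "closed_H3 = {Point z t | z t. t > 0} \<union> range Ideal \<union> {Infty}"

text \<open>
  The norm on \<^typ>\<open>complex \<times> real\<close> is the Euclidean one, so the integrand is the norm of the
  velocity for the metric \<open>(|dz|\<^sup>2 + dt\<^sup>2) / t\<^sup>2\<close>.  Paths are C1 up to the end points: the library's
  \<open>valid_path\<close> allows an unbounded derivative, and the integral of a non-integrable speed would
  be 0.
\<close>

definition hlength :: "(real \<Rightarrow> complex \<times> real) \<Rightarrow> real" where
  "hlength \<gamma> = integral {0..1} (\<lambda>s. norm (vector_derivative \<gamma> (at s)) / snd (\<gamma> s))"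

definition hdist :: "complex \<times> real \<Rightarrow> complex \<times> real \<Rightarrow> real" where
  "hdist x y = Inf {hlength \<gamma> | \<gamma>. \<gamma> C1_differentiable_on {0..1} \<and> path_image \<gamma> \<subseteq> H3
                                \<and> pathstart \<gamma> = x \<and> pathfinish \<gamma> = y}"

definition geodesic_line :: "(real \<Rightarrow> complex \<times> real) \<Rightarrow> bool" where
  "geodesic_line \<gamma> \<longleftrightarrow> range \<gamma> \<subseteq> H3 \<and> (\<forall>s s'. hdist (\<gamma> s) (\<gamma> s') = \<bar>s - s'\<bar>)"

text \<open>
  Convergence to an ideal point, in the topology of the closed half-space with \<open>\<infinity>\<close> added as
  its one-point compactification.
\<close>

fun tends_to_ideal :: "(real \<Rightarrow> complex \<times> real) \<Rightarrow> real filter \<Rightarrow> hpoint \<Rightarrow> bool" where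
  "tends_to_ideal \<gamma> F (Point z t) \<longleftrightarrow> False"
| "tends_to_ideal \<gamma> F (Ideal \<beta>) \<longleftrightarrow> (\<gamma> \<longlongrightarrow> (\<beta>, 0)) F"
| "tends_to_ideal \<gamma> F Infty \<longleftrightarrow> filterlim \<gamma> at_infinity F"

text \<open>
  \<open>line_at \<gamma> u p\<close>: the line \<open>\<gamma>\<close>, completed by its two ideal end points at the times \<open>\<plusminus>\<infinity>\<close>,
  is at the point \<open>p\<close> at time \<open>u\<close>.
\<close>

fun line_at :: "(real \<Rightarrow> complex \<times> real) \<Rightarrow> ereal \<Rightarrow> hpoint \<Rightarrow> bool" where
  "line_at \<gamma> (ereal s) p \<longleftrightarrow> p = Point (fst (\<gamma> s)) (snd (\<gamma> s))"
| "line_at \<gamma> PInfty p \<longleftrightarrow> tends_to_ideal \<gamma> at_top p"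
| "line_at \<gamma> MInfty p \<longleftrightarrow> tends_to_ideal \<gamma> at_bot p"

definition hsegment :: "hpoint \<Rightarrow> hpoint \<Rightarrow> hpoint set" where
  "hsegment p q = {x. \<exists>\<gamma> u v w. geodesic_line \<gamma> \<and> line_at \<gamma> u p \<and> line_at \<gamma> v q
                              \<and> u \<le> w \<and> w \<le> v \<and> line_at \<gamma> w x}"

definition hconvex :: "hpoint set \<Rightarrow> bool" where
  "hconvex C \<longleftrightarrow> C \<subseteq> closed_H3 \<and> (\<forall>p\<in>C. \<forall>q\<in>C. hsegment p q \<subseteq> C)"

definition hermitian_form :: "real \<Rightarrow> complex \<Rightarrow> real \<Rightarrow> complex \<Rightarrow> complex \<Rightarrow> complex" where
  "hermitian_form a b c X Z =
     a * (cmod X)\<^sup>2 - b * X * cnj Z - cnj b * cnj X * Z + c * (cmod Z)\<^sup>2"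

definition discriminant :: "real \<Rightarrow> complex \<Rightarrow> real \<Rightarrow> real" where
  "discriminant a b c = a * c - (cmod b)\<^sup>2"

fun point_form :: "hpoint \<Rightarrow> complex \<Rightarrow> complex \<Rightarrow> complex" where
  "point_form (Point z t) = hermitian_form 1 (cnj z) ((cmod z)\<^sup>2 + t\<^sup>2)"
| "point_form (Ideal \<beta>) = (\<lambda>X Z. (X - \<beta> * Z) * (cnj X - cnj \<beta> * cnj Z))"
| "point_form Infty = (\<lambda>X Z. (cmod Z)\<^sup>2)"

inductive has_zero :: "(complex \<Rightarrow> complex \<Rightarrow> complex) \<Rightarrow> hpoint \<Rightarrow> bool" where
  interior: "discriminant a b c > 0 \<Longrightarrow> a > 0 \<Longrightarrow>
     has_zero (hermitian_form a b c) (Point (cnj b / a) (sqrt (discriminant a b c) / a))"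
| ideal: "r > 0 \<Longrightarrow>
     has_zero (\<lambda>X Z. complex_of_real r * point_form (Ideal \<beta>) X Z) (Ideal \<beta>)"
| infty: "r > 0 \<Longrightarrow>
     has_zero (\<lambda>X Z. complex_of_real r * point_form Infty X Z) Infty"

definition form_zero :: "(complex \<Rightarrow> complex \<Rightarrow> complex) \<Rightarrow> hpoint" (\<open>\<xi>\<close>) where
  "\<xi> H = (THE p. has_zero H p)"

definition combination :: "nat \<Rightarrow> (nat \<Rightarrow> hpoint) \<Rightarrow> (nat \<Rightarrow> real) \<Rightarrow> complex \<Rightarrow> complex \<Rightarrow> complex" where
  "combination n \<omega> l = (\<lambda>X Z. \<Sum>i=1..n. complex_of_real (l i) * point_form (\<omega> i) X Z)"

end

theory Submission
  imports Defs
begin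

text \<open>
  The Hermitian forms make up the four-dimensional real vector space of triples \<open>(a, b, c)\<close>, and the
  discriminant \<open>a c - |b|\<^sup>2\<close> is a quadratic form of signature \<open>(1, 3)\<close> on it.  The zero map sends the rays of
  the closed future cone of this Minkowski space bijectively to the points of the closed half-space:
  timelike rays to interior points, lightlike rays to ideal points.  In this hyperboloid model the
  theorem says that hyperbolic convexity is linear convexity of the cone, which comes down to one
  fact about two distinct points: the hyperbolic segment from \<open>p\<close> to \<open>q\<close> consists of the zeros of the
  combinations \<open>l H\<^sub>p + m H\<^sub>q\<close> with nonnegative coefficients (\<open>hsegment_imp_combination\<close>,
  \<open>combination_imp_hsegment\<close>).  The first half shows that the set of all zeros of combinations is
  convex; the second, applied to one summand at a time, shows that every convex set
  containing the \<open>\<omega>\<^sub>i\<close> contains these zeros.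

  For segments one must know all geodesic lines of a metric that is given as an infimum of lengths.  Let
  \<open>N\<close> and \<open>M\<close> be lightlike with product \<open>1/2\<close>.  The curve \<open>exp (-s) N + exp s M\<close> on the unit
  hyperboloid has unit speed, which bounds distances along it from above.  The Busemann function
  \<open>ln \<langle>x, M\<rangle>\<close> is smooth with gradient of norm at most 1 and decreases by exactly \<open>v - u\<close> between times
  \<open>u\<close> and \<open>v\<close> of the curve, which gives the matching lower bound
  (\<open>busemann_le_hlength\<close>, \<open>hdist_null_line\<close>).  As any two distinct points lie on such a curve, \<open>cosh\<close> of the
  distance is the Minkowski product of the unit vectors (\<open>mink_unit_vec_eq_cosh_hdist\<close>).
  Conversely, the distances of a point of a geodesic line from two others determine its Minkowski product
  with the curve through them, and a product of 1 forces two unit vectors to coincide; so there are no other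
  geodesic lines (\<open>geodesic_line_imp_null_line\<close>).  The ideal end points of the curve are the
  zeros of \<open>N\<close> and \<open>M\<close>, so that all its points, ideal or not, are nonnegative combinations of
  \<open>N\<close> and \<open>M\<close>, ordered by the ratio of the coefficients; this is the claim about segments.
\<close>

section \<open>The Minkowski space of Hermitian forms\<close>

type_synonym herm = "real \<times> complex \<times> real"

text \<open>
  The polarisation of the discriminant.
\<close>

definition mink :: "herm \<Rightarrow> herm \<Rightarrow> real" where
  "mink X Y = (fst X * snd (snd Y) + snd (snd X) * fst Y) / 2 - fst (snd X) \<bullet> fst (snd Y)"

lemma mink_simps [simp]:
  "mink (X + Y) W = mink X W + mink Y W"
  "mink W (X + Y) = mink W X + mink W Y"
  "mink (X - Y) W = mink X W - mink Y W"
  "mink W (X - Y) = mink W X - mink W Y"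
  "mink (r *\<^sub>R X) W = r * mink X W"
  "mink W (r *\<^sub>R X) = r * mink W X"
  by (auto simp: mink_def inner_simps field_simps)

lemma mink_commute: "mink X Y = mink Y X"
  by (simp add: mink_def inner_commute)

lemma mink_self: "mink X X = fst X * snd (snd X) - (norm (fst (snd X)))\<^sup>2"
  by (simp add: mink_def dot_square_norm)

text \<open>
  The closed future cone without its apex, so that every element has a zero.
\<close>

definition future :: "herm set" where
  "future = {X. X \<noteq> 0 \<and> fst X \<ge> 0 \<and> snd (snd X) \<ge> 0 \<and> mink X X \<ge> 0}"

lemma mink_nonneg:
  assumes "X \<in> future" "Y \<in> future"
  shows "mink X Y \<ge> 0"
proof -
  obtain a b c where X: "X = (a, b, c)" by (cases X) auto
  obtain a' b' c' where Y: "Y = (a', b', c')" by (cases Y) auto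
  have h: "a \<ge> 0" "c \<ge> 0" "a' \<ge> 0" "c' \<ge> 0" "(norm b)\<^sup>2 \<le> a * c" "(norm b')\<^sup>2 \<le> a' * c'"
    using assms by (auto simp: future_def X Y mink_def power2_norm_eq_inner)
  have "b \<bullet> b' \<le> norm b * norm b'" by (rule norm_cauchy_schwarz)
  also have "\<dots> \<le> (a * c' + c * a') / 2"
  proof (rule power2_le_imp_le)
    have "(norm b * norm b')\<^sup>2 \<le> (a * c) * (a' * c')"
      unfolding power_mult_distrib by (intro mult_mono h) (use h in auto)
    also have "\<dots> \<le> ((a * c' + c * a') / 2)\<^sup>2"
      using zero_le_power2[of "a * c' - c * a'"] by (simp add: power2_eq_square field_simps)
    finally show "(norm b * norm b')\<^sup>2 \<le> ((a * c' + c * a') / 2)\<^sup>2" .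
  qed (use h in auto)
  finally show ?thesis by (simp add: X Y mink_def)
qed

lemma future_fst_pos:
  assumes "X \<in> future" "mink X X > 0"
  shows "fst X > 0"
proof -
  have "fst X * snd (snd X) > 0"
    using assms(2) zero_le_power2[of "norm (fst (snd X))"] unfolding mink_self by linarith
  with assms(1) show ?thesis
    by (auto simp: future_def less_le)
qed

lemma future_scaleR: "X \<in> future \<Longrightarrow> r > 0 \<Longrightarrow> r *\<^sub>R X \<in> future"
  by (auto simp: future_def)

lemma future_add:
  assumes "X \<in> future" "Y \<in> future"
  shows "X + Y \<in> future"
proof -
  have "mink (X + Y) (X + Y) \<ge> 0"
    using assms mink_nonneg[OF assms] mink_nonneg[OF assms(2,1)] by (simp add: future_def)
  moreover have "X + Y \<noteq> 0"
  proof
    assume "X + Y = 0"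
    then have eq: "fst X + fst Y = 0" "snd (snd X) + snd (snd Y) = 0"
      by (auto simp: prod_eq_iff)
    with assms have "fst X = 0" "snd (snd X) = 0" "X \<noteq> 0" "mink X X \<ge> 0"
      by (auto simp: future_def)
    then show False
      by (auto simp: mink_self prod_eq_iff)
  qed
  ultimately show ?thesis
    using assms by (auto simp: future_def)
qed

text \<open>
  The orthogonal complement of a timelike vector is negative definite.  All rigidity below
  comes from here.
\<close>

lemma orthogonal_timelike_zero:
  assumes X: "X \<in> future" "mink X X > 0" and D: "mink X D = 0" "mink D D \<ge> 0"
  shows "D = 0"
proof (rule ccontr)
  assume "D \<noteq> 0"
  obtain a b c where Xe: "X = (a, b, c)" by (cases X) auto
  obtain a' b' c' where De: "D = (a', b', c')" by (cases D) auto
  have h: "a \<ge> 0" "c \<ge> 0" "(norm b)\<^sup>2 < a * c" "(norm b')\<^sup>2 \<le> a' * c'"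
    using X D by (auto simp: future_def Xe De mink_def power2_norm_eq_inner)
  have "a * c > 0" using h(3) zero_le_power2[of "norm b"] by linarith
  with h have a: "a > 0" "c > 0" by (auto simp: zero_less_mult_iff)
  have orth: "b \<bullet> b' = (a * c' + c * a') / 2"
    using D by (simp add: Xe De mink_def)
  have "((a * c' + c * a') / 2)\<^sup>2 \<le> (norm b)\<^sup>2 * (norm b')\<^sup>2"
    unfolding orth[symmetric] using Cauchy_Schwarz_ineq2[of b b']
    by (metis abs_le_square_iff abs_mult abs_norm_cancel power_mult_distrib)
  moreover have "(norm b)\<^sup>2 * (norm b')\<^sup>2 \<le> (a * c) * (norm b')\<^sup>2"
    using h by (intro mult_right_mono) auto
  moreover have "(a * c) * (norm b')\<^sup>2 \<le> (a * c) * (a' * c')"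
    using h by (intro mult_left_mono) auto
  moreover have "((a * c' + c * a') / 2)\<^sup>2 = (a * c) * (a' * c') + ((a * c' - c * a') / 2)\<^sup>2"
    by (simp add: power2_eq_square field_simps)
  moreover have "((a * c' - c * a') / 2)\<^sup>2 \<ge> 0" by simp
  ultimately have eq: "((a * c' - c * a') / 2)\<^sup>2 = 0" "(norm b)\<^sup>2 * (norm b')\<^sup>2 = (a * c) * (norm b')\<^sup>2"
      "(a * c) * (norm b')\<^sup>2 = (a * c) * (a' * c')"
    by linarith+
  from eq(2) h have b': "b' = 0" by auto
  have "a * c' = c * a'" using eq(1) by simp
  moreover have "a * c' + c * a' = 0" using orth b' by simp
  ultimately have "a' = 0" "c' = 0" using a by auto
  with b' \<open>D \<noteq> 0\<close> show False by (simp add: De zero_prod_def)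
qed

text \<open>
  The negative of a vector of the past cone would have a nonnegative product with \<open>P\<close>.
\<close>

lemma future_if_mink_pos:
  assumes P: "P \<in> future" and X: "mink X X \<ge> 0" "mink P X > 0"
  shows "X \<in> future"
proof (rule ccontr)
  assume n: "X \<notin> future"
  have X0: "X \<noteq> 0" using X by (auto simp: mink_def)
  have "fst X * snd (snd X) \<ge> 0"
    using X(1) zero_le_power2[of "norm (fst (snd X))"] unfolding mink_self by linarith
  then have "fst X \<le> 0" "snd (snd X) \<le> 0"
    using n X0 X(1) by (auto simp: future_def zero_le_mult_iff)
  then have "- X \<in> future"
    using X0 X(1) by (auto simp: future_def mink_def)
  then have "mink P (- 1 *\<^sub>R X) \<ge> 0"
    using mink_nonneg[OF P] by simp
  with X(2) show False
    unfolding mink_simps by simp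
qed

lemma mink_pos:
  assumes "P \<in> future" "mink P P > 0" "X \<in> future"
  shows "mink P X > 0"
proof -
  have "mink P X \<noteq> 0"
    using assms orthogonal_timelike_zero[of P X] by (auto simp: future_def)
  then show ?thesis using mink_nonneg[OF assms(1,3)] by simp
qed

section \<open>Points of the closed half-space as rays of the future cone\<close>

fun coords :: "hpoint \<Rightarrow> herm" where
  "coords (Point z t) = (1, cnj z, (cmod z)\<^sup>2 + t\<^sup>2)"
| "coords (Ideal \<beta>) = (1, cnj \<beta>, (cmod \<beta>)\<^sup>2)"
| "coords Infty = (0, 0, 1)"

definition form_of :: "herm \<Rightarrow> complex \<Rightarrow> complex \<Rightarrow> complex" where
  "form_of X = hermitian_form (fst X) (fst (snd X)) (snd (snd X))"

lemma form_of_coords: "form_of (coords p) = point_form p"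
proof (cases p)
  case (Ideal \<beta>)
  then show ?thesis
    by (auto simp: form_of_def hermitian_form_def fun_eq_iff complex_norm_square algebra_simps
          simp del: of_real_power)
qed (auto simp: form_of_def hermitian_form_def fun_eq_iff)

lemma form_of_add: "form_of (X + Y) A B = form_of X A B + form_of Y A B"
  by (simp add: form_of_def hermitian_form_def algebra_simps)

lemma form_of_scaleR: "form_of (r *\<^sub>R X) A B = of_real r * form_of X A B"
  by (simp add: form_of_def hermitian_form_def algebra_simps scaleR_conv_of_real)

lemma form_of_sum:
  "form_of (\<Sum>i\<in>I. l i *\<^sub>R X i) A B = (\<Sum>i\<in>I. of_real (l i) * form_of (X i) A B)"
proof (induction I rule: infinite_finite_induct)
  case (insert i I)
  then show ?case by (simp add: form_of_add form_of_scaleR)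
qed (simp_all add: form_of_def hermitian_form_def)

lemma form_of_inject: "form_of X = form_of Y \<longleftrightarrow> X = Y"
proof
  assume eq: "form_of X = form_of Y"
  obtain a b c where X: "X = (a, b, c)" by (cases X) auto
  obtain a' b' c' where Y: "Y = (a', b', c')" by (cases Y) auto
  have "form_of X 1 0 = form_of Y 1 0" "form_of X 0 1 = form_of Y 0 1"
       "form_of X 1 1 = form_of Y 1 1" "form_of X \<i> 1 = form_of Y \<i> 1"
    using eq by auto
  then show "X = Y"
    by (auto simp: X Y form_of_def hermitian_form_def complex_eq_iff)
qed auto

text \<open>
  The ray of \<open>X\<close> is the point \<open>p\<close>; by \<open>has_zero_iff\<close> below, \<open>p\<close> is the zero of the form \<open>X\<close>.
\<close>

definition represents :: "herm \<Rightarrow> hpoint \<Rightarrow> bool" where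
  "represents X p \<longleftrightarrow> p \<in> closed_H3 \<and> (\<exists>r>0. X = r *\<^sub>R coords p)"

lemma closed_H3_iff [simp]:
  "Point z t \<in> closed_H3 \<longleftrightarrow> t > 0" "Ideal \<beta> \<in> closed_H3" "Infty \<in> closed_H3"
  by (auto simp: closed_H3_def)

lemma represents_coords: "p \<in> closed_H3 \<Longrightarrow> represents (coords p) p"
  unfolding represents_def by (auto intro!: exI[of _ 1])

lemma represents_scaleR:
  assumes "represents X p" "r > 0"
  shows "represents (r *\<^sub>R X) p"
proof -
  obtain s where "p \<in> closed_H3" "s > 0" "X = s *\<^sub>R coords p"
    using assms(1) unfolding represents_def by blast
  with assms(2) show ?thesis
    unfolding represents_def by (intro conjI exI[of _ "r * s"]) simp_all
qed

lemma has_zero_iff: "has_zero (form_of X) p \<longleftrightarrow> represents X p"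
proof
  assume "has_zero (form_of X) p"
  then show "represents X p"
  proof cases
    case (interior a b c)
    from interior(1) have X: "X = (a, b, c)"
      using form_of_inject[of X "(a, b, c)"] by (simp add: form_of_def)
    have "(cmod b / a)\<^sup>2 + (sqrt (discriminant a b c) / a)\<^sup>2 = ((cmod b)\<^sup>2 + discriminant a b c) / a\<^sup>2"
      using interior by (simp add: power_divide add_divide_distrib)
    also have "\<dots> = c / a" using interior by (simp add: discriminant_def power2_eq_square)
    finally have "X = a *\<^sub>R coords p"
      using interior by (simp add: X norm_divide scaleR_conv_of_real)
    then show ?thesis using interior by (auto simp: represents_def)
  next
    case (ideal r \<beta>)
    have "form_of X = form_of (r *\<^sub>R coords (Ideal \<beta>))"
      unfolding ideal(1) by (intro ext) (simp only: form_of_scaleR form_of_coords)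
    then show ?thesis
      unfolding form_of_inject represents_def using ideal by auto
  next
    case (infty r)
    have "form_of X = form_of (r *\<^sub>R coords Infty)"
      unfolding infty(1) by (intro ext) (simp only: form_of_scaleR form_of_coords)
    then show ?thesis
      unfolding form_of_inject represents_def using infty by auto
  qed
next
  assume "represents X p"
  then obtain r where p: "p \<in> closed_H3" and r: "r > 0" and X: "X = r *\<^sub>R coords p"
    by (auto simp: represents_def)
  have f: "form_of X = (\<lambda>A B. of_real r * point_form p A B)"
    unfolding X by (intro ext) (simp only: form_of_scaleR form_of_coords)
  show "has_zero (form_of X) p"
  proof (cases p)
    case (Point z t)
    with p have t: "t > 0" by simp
    let ?c = "r * ((cmod z)\<^sup>2 + t\<^sup>2)"
    have d: "discriminant r (r *\<^sub>R cnj z) ?c = (r * t)\<^sup>2"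
      by (simp add: discriminant_def power2_eq_square algebra_simps)
    have "has_zero (hermitian_form r (r *\<^sub>R cnj z) ?c)
       (Point (cnj (r *\<^sub>R cnj z) / r) (sqrt (discriminant r (r *\<^sub>R cnj z) ?c) / r))"
      using r t by (intro has_zero.interior) (auto simp: d)
    moreover have "cnj (r *\<^sub>R cnj z) / r = z"
      using r by (simp add: scaleR_conv_of_real)
    moreover have "sqrt (discriminant r (r *\<^sub>R cnj z) ?c) / r = t"
      unfolding d using r t by simp
    ultimately show ?thesis
      by (simp add: form_of_def X Point)
  next
    case (Ideal \<beta>)
    show ?thesis unfolding f Ideal by (rule has_zero.ideal[OF r])
  next
    case Infty
    show ?thesis unfolding f Infty by (rule has_zero.infty[OF r])
  qed
qed

lemma coords_future: "p \<in> closed_H3 \<Longrightarrow> coords p \<in> future"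
  by (cases p) (auto simp: future_def mink_def zero_prod_def dot_square_norm)

lemma coords_nonzero: "p \<in> closed_H3 \<Longrightarrow> coords p \<noteq> 0"
  using coords_future by (auto simp: future_def)

lemma represents_future: "represents X p \<Longrightarrow> X \<in> future"
  by (auto simp: represents_def intro!: future_scaleR coords_future)

lemma represents_unique:
  assumes "represents X p" "represents X q"
  shows "p = q"
proof -
  obtain r s where rs: "r > 0" "s > 0" "r *\<^sub>R coords p = s *\<^sub>R coords q"
      and cl: "p \<in> closed_H3" "q \<in> closed_H3"
    using assms by (auto simp: represents_def)
  have sq: "(t::real)\<^sup>2 = 0 \<longleftrightarrow> t = 0" "t > 0 \<Longrightarrow> u > 0 \<Longrightarrow> t\<^sup>2 = u\<^sup>2 \<longleftrightarrow> t = u" for t u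
    by (auto simp: power2_eq_iff)
  show ?thesis
    using rs cl by (cases p; cases q) (auto simp: sq)
qed

lemma ex_represents:
  assumes "X \<in> future"
  shows "\<exists>p. represents X p"
proof -
  obtain a b c where X: "X = (a, b, c)" by (cases X) auto
  have h: "a \<ge> 0" "c \<ge> 0" "(cmod b)\<^sup>2 \<le> a * c" "X \<noteq> 0"
    using assms by (auto simp: future_def X mink_def power2_norm_eq_inner)
  consider "a = 0" | "a > 0" "(cmod b)\<^sup>2 = a * c" | "a > 0" "(cmod b)\<^sup>2 < a * c"
    using h by fastforce
  then show ?thesis
  proof cases
    case 1
    with h have "b = 0" "c > 0" by (auto simp: X zero_prod_def less_le)
    with 1 have "represents X Infty"
      by (auto simp: represents_def X)
    then show ?thesis ..
  next
    case 2
    have "X = a *\<^sub>R coords (Ideal (cnj b / a))"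
      using 2 by (simp add: X norm_divide power_divide scaleR_conv_of_real power2_eq_square)
    with 2 show ?thesis by (auto simp: represents_def intro!: exI[of _ "Ideal (cnj b / a)"])
  next
    case 3
    then have "has_zero (form_of X) (Point (cnj b / a) (sqrt (discriminant a b c) / a))"
      unfolding X form_of_def fst_conv snd_conv
      by (intro has_zero.interior) (auto simp: discriminant_def)
    then show ?thesis by (auto simp: has_zero_iff)
  qed
qed

lemma combination_eq: "combination n \<omega> l = form_of (\<Sum>i=1..n. l i *\<^sub>R coords (\<omega> i))"
  by (intro ext) (simp only: combination_def form_of_sum form_of_coords)

lemma form_zero_eq: "represents X p \<Longrightarrow> \<xi> (form_of X) = p"
  unfolding form_zero_def has_zero_iff by (blast intro: represents_unique)

section \<open>The hyperbolic distance on the unit hyperboloid\<close>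

text \<open>
  The bijection of the open half-space with the unit hyperboloid; \<open>hs_point\<close> is its inverse.
\<close>

definition unit_vec :: "complex \<times> real \<Rightarrow> herm" where
  "unit_vec x = (1 / snd x) *\<^sub>R coords (Point (fst x) (snd x))"

definition hs_point :: "herm \<Rightarrow> complex \<times> real" where
  "hs_point X = (1 / fst X) *\<^sub>R (cnj (fst (snd X)), 1)"

lemma mink_unit_vec: "x \<in> H3 \<Longrightarrow> mink (unit_vec x) (unit_vec x) = 1"
  by (simp add: unit_vec_def mink_self H3_def field_simps power2_eq_square)

lemma unit_vec_future: "x \<in> H3 \<Longrightarrow> unit_vec x \<in> future"
  unfolding unit_vec_def H3_def by (intro future_scaleR coords_future) auto

lemma represents_unit_vec: "x \<in> H3 \<Longrightarrow> represents (unit_vec x) (Point (fst x) (snd x))"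
  unfolding unit_vec_def H3_def represents_def by (auto intro!: exI[of _ "1 / snd x"])

lemma hs_point_unit_vec: "x \<in> H3 \<Longrightarrow> hs_point (unit_vec x) = x"
  by (cases x) (auto simp: hs_point_def unit_vec_def H3_def)

lemma unit_vec_inject: "x \<in> H3 \<Longrightarrow> y \<in> H3 \<Longrightarrow> unit_vec x = unit_vec y \<Longrightarrow> x = y"
  by (metis hs_point_unit_vec)

lemma hs_point_H3: "fst X > 0 \<Longrightarrow> hs_point X \<in> H3"
  by (simp add: hs_point_def H3_def)

lemma unit_vec_hs_point:
  assumes "fst X > 0" "mink X X = 1"
  shows "unit_vec (hs_point X) = X"
proof -
  obtain a b c where X: "X = (a, b, c)" by (cases X) auto
  have a: "a > 0" and "a * c = 1 + (cmod b)\<^sup>2"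
    using assms by (auto simp: X mink_self)
  then have "c = (1 + (cmod b)\<^sup>2) / a" by (simp add: field_simps)
  then have "c = (cmod b / a)\<^sup>2 * a + (1 / a)\<^sup>2 * a"
    using a by (simp add: field_simps power2_eq_square)
  with a show ?thesis
    by (simp add: unit_vec_def hs_point_def X norm_mult algebra_simps)
qed

lemma mink_eq_1_imp_eq:
  assumes "X \<in> future" "mink X X = 1" "mink Y Y = 1" "mink X Y = 1"
  shows "Y = X"
proof -
  have "Y - X = 0"
    by (rule orthogonal_timelike_zero[of X]) (use assms in \<open>auto simp: mink_commute\<close>)
  then show ?thesis by simp
qed

text \<open>
  The component of \<open>Y\<close> orthogonal to \<open>X\<close> has square \<open>1 - \<langle>X, Y\<rangle>\<^sup>2\<close>, which is negative unless the component is 0.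
\<close>

lemma mink_gt_1:
  assumes X: "X \<in> future" "mink X X = 1" and Y: "Y \<in> future" "mink Y Y = 1" and "X \<noteq> Y"
  shows "mink X Y > 1"
proof -
  define B where "B = mink X Y"
  define D where "D = Y - B *\<^sub>R X"
  have B0: "B \<ge> 0" unfolding B_def using X Y by (intro mink_nonneg)
  have orth: "mink X D = 0" by (simp add: D_def B_def X)
  have norm: "mink D D = 1 - B\<^sup>2"
    by (simp add: D_def X Y mink_commute[of Y X] flip: B_def) (simp add: power2_eq_square)
  have "mink D D < 0"
  proof (rule ccontr)
    assume "\<not> mink D D < 0"
    with orth X have "D = 0" by (intro orthogonal_timelike_zero[of X]) auto
    with norm have "B\<^sup>2 = 1" by (simp add: mink_self)
    with B0 have "B = 1" by (metis abs_of_nonneg abs_1 power2_eq_1_iff one_neq_neg_one abs_minus)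
    with \<open>D = 0\<close> \<open>X \<noteq> Y\<close> show False by (simp add: D_def)
  qed
  then have "1\<^sup>2 < B\<^sup>2" by (simp add: norm)
  then show ?thesis unfolding B_def[symmetric] using B0 by (rule power2_less_imp_less)
qed

text \<open>
  The normalisation of the product makes \<open>N + M\<close>, and with it all of \<open>exp (-s) N + exp s M\<close>, a unit vector.
\<close>

definition null_frame :: "herm \<Rightarrow> herm \<Rightarrow> bool" where
  "null_frame N M \<longleftrightarrow> N \<in> future \<and> M \<in> future \<and> mink N N = 0 \<and> mink M M = 0 \<and> mink N M = 1 / 2"

lemma null_frame_commute: "null_frame N M \<longleftrightarrow> null_frame M N"
  by (auto simp: null_frame_def mink_commute)

definition boost :: "herm \<Rightarrow> herm \<Rightarrow> real \<Rightarrow> herm" where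
  "boost N M s = exp (- s) *\<^sub>R N + exp s *\<^sub>R M"

lemma boost_future: "null_frame N M \<Longrightarrow> boost N M s \<in> future"
  unfolding boost_def null_frame_def by (intro future_add future_scaleR) auto

lemma mink_boost: "null_frame N M \<Longrightarrow> mink (boost N M s) (boost N M s') = cosh (s - s')"
  unfolding boost_def null_frame_def 
  by (simp add: mink_commute[of M N] cosh_def exp_diff exp_minus field_simps)

lemma boost_unit: "null_frame N M \<Longrightarrow> mink (boost N M s) (boost N M s) = 1"
  by (simp add: mink_boost)

lemma fst_boost_pos: "null_frame N M \<Longrightarrow> fst (boost N M s) > 0"
  by (intro future_fst_pos boost_future) (simp_all add: boost_unit)

definition null_line :: "herm \<Rightarrow> herm \<Rightarrow> real \<Rightarrow> complex \<times> real" where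
  "null_line N M s = hs_point (boost N M s)"

lemma unit_vec_null_line: "null_frame N M \<Longrightarrow> unit_vec (null_line N M s) = boost N M s"
  unfolding null_line_def by (intro unit_vec_hs_point fst_boost_pos boost_unit)

lemma null_line_H3: "null_frame N M \<Longrightarrow> null_line N M s \<in> H3"
  unfolding null_line_def by (intro hs_point_H3 fst_boost_pos)

text \<open>
  The vectors come from solving \<open>P = N + M\<close>, \<open>Q = exp (-d) N + exp d M\<close> with \<open>cosh d = \<langle>P, Q\<rangle>\<close>.
\<close>

lemma null_frame_through:
  assumes P: "P \<in> future" "mink P P = 1" "Q \<in> future" "mink Q Q = 1" "mink P Q > 1"
  obtains N M d where "null_frame N M" "d > 0" "P = boost N M 0" "Q = boost N M d"
proof -
  define d where "d = arcosh (mink P Q)"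
  have B: "mink P Q = cosh d" and d: "d > 0"
    using assms by (auto simp: d_def)
  define E where "E = exp d"
  have E: "E > 1" "exp (- d) = 1 / E" "exp d = E" using d by (simp_all add: E_def exp_minus field_simps)
  have BE: "mink P Q = (E + 1 / E) / 2" "mink Q P = (E + 1 / E) / 2"
    using B E by (auto simp: cosh_def mink_commute)
  define k where "k = 1 / (E - 1 / E)"
  have EE: "E * E > 1" using less_1_mult[OF E(1) E(1)] .
  have kEE: "k = E / (E * E - 1)" using E(1) by (simp add: k_def field_simps)
  have nz: "E\<^sup>2 \<noteq> 1" "E \<noteq> 0" and k: "k > 0"
    unfolding kEE using E(1) EE by (auto simp: power2_eq_square)
  define N where "N = k *\<^sub>R (E *\<^sub>R P - Q)"
  define M where "M = k *\<^sub>R (Q - (1 / E) *\<^sub>R P)"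
  have kk: "k * (E - 1 / E) = 1" using k by (simp add: k_def)
  have m: "mink N N = 0" "mink M M = 0"
    using nz by (simp_all add: N_def M_def BE assms field_simps power2_eq_square)
  have "mink P N = k * (E - 1 / E) / 2" "mink P M = k * (E - 1 / E) / 2"
    using nz by (simp_all add: N_def M_def BE assms field_simps)
  with m kk have m: "mink N N = 0" "mink M M = 0" "mink P N = 1 / 2" "mink P M = 1 / 2"
    by simp_all
  have NM: "mink N M = 1 / 2"
  proof -
    have "mink N M = k * k * (E * ((E + 1 / E) / 2) - 1 - 1 + (E + 1 / E) / 2 / E)"
      using nz by (simp add: N_def M_def BE assms) (simp add: field_simps)
    also have "\<dots> = (k * (E - 1 / E)) * (k * (E - 1 / E)) / 2"
      using nz by (simp add: add_divide_distrib algebra_simps)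
    also have "\<dots> = 1 / 2"
      unfolding kk by simp
    finally show ?thesis .
  qed
  have "N \<in> future" "M \<in> future"
    by (rule future_if_mink_pos[OF P(1)]; simp add: m)+
  with m NM have fr: "null_frame N M" by (simp add: null_frame_def)
  have kk: "k * E - k * (1 / E) = 1" using kk by (simp only: right_diff_distrib)
  have "boost N M 0 = (k * E - k * (1 / E)) *\<^sub>R P"
    by (simp add: boost_def N_def M_def scaleR_diff_left scaleR_diff_right)
  then have P0: "P = boost N M 0" by (simp only: kk scaleR_one)
  have "boost N M d = (k * E - k * (1 / E)) *\<^sub>R Q"
    using nz by (simp add: boost_def N_def M_def E scaleR_diff_left scaleR_diff_right mult.commute)
  then have "Q = boost N M d" by (simp only: kk scaleR_one)
  from that[OF fr d P0 this] show thesis .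
qed

text \<open>
  The pointwise bound on the derivative of \<open>ln (p / t)\<close>, the Busemann function of the lightlike
  vector \<open>(\<alpha>, cnj \<beta>, \<kappa>)\<close>, along the velocity \<open>(\<zeta>, \<tau>)\<close>.  The derivative is an inner product of the velocity
  with a vector whose Euclidean norm is \<open>1 / t\<close> because of \<open>\<alpha> \<kappa> = |\<beta>|\<^sup>2\<close>, so the Cauchy-Schwarz inequality
  applies.
\<close>

lemma busemann_integrand:
  fixes z \<zeta> \<beta> :: complex and t \<tau> \<alpha> \<kappa> :: real
  assumes t: "t > 0" and null: "\<alpha> * \<kappa> = (norm \<beta>)\<^sup>2"
    and p: "p = \<kappa> + \<alpha> * (z \<bullet> z + t\<^sup>2) - 2 * (z \<bullet> \<beta>)" "p > 0"
  shows "\<bar>(2 * \<alpha> * (z \<bullet> \<zeta> + t * \<tau>) - 2 * (\<zeta> \<bullet> \<beta>)) / p - \<tau> / t\<bar> \<le> norm (\<zeta>, \<tau>) / t"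
proof -
  define w where "w = \<alpha> *\<^sub>R z - \<beta>"
  have w: "w \<bullet> w = \<alpha> * (p - \<alpha> * t\<^sup>2)"
    using null by (simp add: w_def p inner_simps inner_commute flip: dot_square_norm)
      (simp add: algebra_simps power2_eq_square)
  \<comment> \<open>\<open>W / (p t)\<close> is the Euclidean gradient of \<open>ln (p / t)\<close>.\<close>
  define W where "W = ((2 * t) *\<^sub>R w, 2 * \<alpha> * t\<^sup>2 - p)"
  have "W \<bullet> W = p\<^sup>2"
    by (simp add: W_def w) (simp add: algebra_simps power2_eq_square)
  then have nW: "norm W = p"
    using p(2) by (simp add: norm_eq_sqrt_inner)
  have "(2 * \<alpha> * (z \<bullet> \<zeta> + t * \<tau>) - 2 * (\<zeta> \<bullet> \<beta>)) / p - \<tau> / t = ((\<zeta>, \<tau>) \<bullet> W) / (p * t)"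
    using t p(2) by (simp add: W_def w_def inner_simps inner_commute field_simps power2_eq_square)
  moreover have "\<bar>(\<zeta>, \<tau>) \<bullet> W\<bar> \<le> norm (\<zeta>, \<tau>) * p"
    using Cauchy_Schwarz_ineq2[of "(\<zeta>, \<tau>)" W] nW by simp
  ultimately show ?thesis
    using t p(2) by (simp add: abs_mult divide_simps mult.commute)
qed

text \<open>
  Busemann functions are 1-Lipschitz for the length of paths.  Unlike the distance from a point they are
  smooth everywhere, so their change along a path is the integral of a derivative.
\<close>

lemma busemann_le_hlength:
  assumes \<gamma>: "\<gamma> C1_differentiable_on {0..1}" "path_image \<gamma> \<subseteq> H3"
    and N: "N \<in> future" "mink N N = 0"
  shows "\<bar>ln (mink (unit_vec (pathfinish \<gamma>)) N) - ln (mink (unit_vec (pathstart \<gamma>)) N)\<bar> \<le> hlength \<gamma>"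
proof -
  obtain D where D: "\<And>s. s \<in> {0..1} \<Longrightarrow> (\<gamma> has_vector_derivative D s) (at s)"
      and contD: "continuous_on {0..1} D"
    using \<gamma>(1) unfolding C1_differentiable_on_def by blast
  obtain \<alpha> \<beta> \<kappa> where Ne: "N = (\<alpha>, \<beta>, \<kappa>)" by (cases N) auto
  have null: "\<alpha> * \<kappa> = (norm (cnj \<beta>))\<^sup>2" using N(2) by (simp add: Ne mink_self)
  define p where "p x = \<kappa> + \<alpha> * (fst x \<bullet> fst x + (snd x)\<^sup>2) - 2 * (fst x \<bullet> cnj \<beta>)" for x :: "complex \<times> real"
  have H: "\<gamma> s \<in> H3" "snd (\<gamma> s) > 0" if "s \<in> {0..1}" for s
    using \<gamma>(2) that by (auto simp: path_image_def H3_def image_subset_iff)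
  have mp: "mink (unit_vec x) N = p x / (2 * snd x)" if "snd x > 0" for x
    using that by (simp add: unit_vec_def Ne mink_def p_def dot_square_norm inner_complex_def field_simps)
  have p_pos: "p x > 0" if "x \<in> H3" for x
  proof -
    have x: "snd x > 0" using that by (simp add: H3_def)
    have "mink (unit_vec x) N > 0"
      using that N mink_pos[of "unit_vec x" N] by (simp add: mink_unit_vec unit_vec_future)
    then show ?thesis
      using x by (simp add: mp zero_less_divide_iff)
  qed
  define F where "F s = ln (p (\<gamma> s)) - ln (snd (\<gamma> s))" for s
  define F' where "F' s = (2 * \<alpha> * (fst (\<gamma> s) \<bullet> fst (D s) + snd (\<gamma> s) * snd (D s))
        - 2 * (fst (D s) \<bullet> cnj \<beta>)) / p (\<gamma> s) - snd (D s) / snd (\<gamma> s)" for s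
  have deriv: "(F has_vector_derivative F' s) (at s within {0..1})" if s: "s \<in> {0..1}" for s
  proof -
    have g: "(\<gamma> has_derivative (\<lambda>h. h *\<^sub>R D s)) (at s)"
      using D[OF s] by (simp add: has_vector_derivative_def)
    define p' where "p' = 2 * \<alpha> * (fst (\<gamma> s) \<bullet> fst (D s) + snd (\<gamma> s) * snd (D s)) - 2 * (fst (D s) \<bullet> cnj \<beta>)"
    have p: "((\<lambda>s. p (\<gamma> s)) has_derivative (\<lambda>h. h * p')) (at s)"
      unfolding p_def p'_def
      by (auto intro!: derivative_eq_intros g simp: inner_commute algebra_simps fun_eq_iff)
    have F': "F' s = p' / p (\<gamma> s) - snd (D s) / snd (\<gamma> s)"
      by (simp add: F'_def p'_def)
    have "(F has_derivative (\<lambda>h. h * F' s)) (at s)"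
      unfolding F_def F' using H[OF s] p_pos[OF H(1)[OF s]]
      by (auto intro!: derivative_eq_intros g p simp: fun_eq_iff divide_inverse algebra_simps)
    then show ?thesis
      by (auto simp: has_vector_derivative_def intro: has_derivative_at_withinI)
  qed
  have int: "(F' has_integral F 1 - F 0) {0..1}"
    using deriv by (intro fundamental_theorem_of_calculus) auto
  have cont\<gamma>: "continuous_on {0..1} \<gamma>"
    using D by (meson continuous_at_imp_continuous_on has_vector_derivative_continuous)
  have "(\<lambda>s. norm (D s) / snd (\<gamma> s)) integrable_on {0..1}"
    using H(2) by (intro integrable_continuous_interval continuous_intros contD cont\<gamma>) force
  moreover have "\<bar>F' s\<bar> \<le> norm (D s) / snd (\<gamma> s)" if s: "s \<in> {0..1}" for s
    using busemann_integrand[OF H(2)[OF s] null p_def p_pos[OF H(1)[OF s]], of "fst (D s)" "snd (D s)"]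
    by (simp add: F'_def)
  ultimately have "norm (integral {0..1} F') \<le> integral {0..1} (\<lambda>s. norm (D s) / snd (\<gamma> s))"
    using int by (intro integral_norm_bound_integral) auto
  moreover have "integral {0..1} (\<lambda>s. norm (D s) / snd (\<gamma> s)) = hlength \<gamma>"
    unfolding hlength_def by (intro integral_cong) (simp add: vector_derivative_at[OF D])
  moreover have "F s = ln (mink (unit_vec (\<gamma> s)) N) + ln 2" if s: "s \<in> {0..1}" for s
    using H[OF s] p_pos[OF H(1)[OF s]] by (simp add: F_def mp ln_div ln_mult)
  ultimately show ?thesis
    using integral_unique[OF int] by (simp add: pathstart_def pathfinish_def)
qed

text \<open>
  The derivative \<open>Y\<close> of the boost \<open>X\<close> satisfies \<open>\<langle>X, Y\<rangle> = 0\<close> and \<open>\<langle>Y, Y\<rangle> = -1\<close>; in the coordinates of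
  the half-space this is unit speed.
\<close>

lemma null_line_derivative:
  assumes fr: "null_frame N M"
  shows "\<exists>D. (\<forall>s. (null_line N M has_vector_derivative D s) (at s)) \<and> continuous_on UNIV D
    \<and> (\<forall>s. norm (D s) / snd (null_line N M s) = 1)"
proof -
  define X where "X = boost N M"
  define Y where "Y s = exp s *\<^sub>R M - exp (- s) *\<^sub>R N" for s
  define D where "D s = (- fst (Y s) / (fst (X s))\<^sup>2) *\<^sub>R (cnj (fst (snd (X s))), 1)
      + (1 / fst (X s)) *\<^sub>R (cnj (fst (snd (Y s))), 0 :: real)" for s
  have a: "fst (X s) > 0" for s unfolding X_def using fr by (rule fst_boost_pos)
  have dX: "(X has_derivative (\<lambda>h. h *\<^sub>R Y s)) (at s)" for s
    unfolding X_def boost_def Y_def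
    by (auto intro!: derivative_eq_intros simp: algebra_simps)
  show ?thesis
  proof (intro exI[of _ D] conjI allI)
    fix s
    have "(null_line N M has_derivative (\<lambda>h. h *\<^sub>R D s)) (at s)"
      unfolding null_line_def hs_point_def D_def X_def[symmetric] using a[of s]
      by (auto intro!: derivative_eq_intros dX simp: algebra_simps power2_eq_square fun_eq_iff)
    then show "(null_line N M has_vector_derivative D s) (at s)"
      by (simp add: has_vector_derivative_def)
    have m: "mink (X s) (X s) = 1" "mink (X s) (Y s) = 0" "mink (Y s) (Y s) = - 1"
      using fr by (auto simp: X_def Y_def boost_def null_frame_def mink_commute[of M N] exp_minus field_simps)
    obtain x y z where Xe: "X s = (x, y, z)" by (cases "X s") auto
    obtain x' y' z' where Ye: "Y s = (x', y', z')" by (cases "Y s") auto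
    have x: "x > 0" using a[of s] by (simp add: Xe)
    have e: "y \<bullet> y = x * z - 1" "y \<bullet> y' = (x * z' + z * x') / 2" "y' \<bullet> y' = x' * z' + 1"
      using m by (auto simp: Xe Ye mink_def)
    have c: "cnj u \<bullet> cnj v = u \<bullet> v" for u v by (simp add: inner_complex_def)
    have "D s \<bullet> D s = (1 / x)\<^sup>2"
      using x by (simp add: D_def Xe Ye inner_simps c e inner_commute[of y' y])
        (simp add: e field_simps power2_eq_square power4_eq_xxxx)
    then have "norm (D s) = 1 / x"
      using x by (simp add: norm_eq_sqrt_inner)
    then show "norm (D s) / snd (null_line N M s) = 1"
      using x by (simp add: null_line_def hs_point_def Xe flip: X_def)
  next
    show "continuous_on UNIV D"
    proof -
      have "continuous_on UNIV X" "continuous_on UNIV Y"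
        unfolding X_def boost_def Y_def by (intro continuous_intros)+
      moreover have "fst (X s) \<noteq> 0" "(fst (X s))\<^sup>2 \<noteq> 0" for s
        using a[of s] by simp_all
      ultimately show ?thesis
        unfolding D_def by (intro continuous_intros ballI) auto
    qed
  qed
qed

lemma hdist_null_line:
  assumes fr: "null_frame N M" and uv: "u \<le> v"
  shows "hdist (null_line N M u) (null_line N M v) = v - u"
  unfolding hdist_def
proof (rule cInf_eq_minimum)
  obtain D where "\<forall>s. (null_line N M has_vector_derivative D s) (at s)" "continuous_on UNIV D"
    "\<forall>s. norm (D s) / snd (null_line N M s) = 1"
    using null_line_derivative[OF fr] by (elim exE conjE)
  then have D: "(null_line N M has_vector_derivative D s) (at s)" "continuous_on UNIV D"
    "norm (D s) / snd (null_line N M s) = 1" for s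
    by (simp_all only: simp_thms)
  define \<gamma> where "\<gamma> s = null_line N M (u + (v - u) * s)" for s
  have d\<gamma>: "(\<gamma> has_vector_derivative (v - u) *\<^sub>R D (u + (v - u) * s)) (at s)" for s
  proof -
    have "((\<lambda>s. u + (v - u) * s) has_vector_derivative (v - u)) (at s)"
      by (auto intro!: derivative_eq_intros)
    from vector_diff_chain_at[OF this D(1)] show ?thesis
      by (simp add: \<gamma>_def[abs_def] comp_def)
  qed
  have "continuous_on {0..1} (\<lambda>s. (v - u) *\<^sub>R D (u + (v - u) * s))"
    by (intro continuous_intros continuous_on_compose2[OF D(2)]) auto
  with d\<gamma> have "\<gamma> C1_differentiable_on {0..1}"
    unfolding C1_differentiable_on_def
    by (intro exI[of _ "\<lambda>s. (v - u) *\<^sub>R D (u + (v - u) * s)"]) auto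
  moreover have "path_image \<gamma> \<subseteq> H3"
    using fr by (auto simp: path_image_def \<gamma>_def null_line_H3)
  moreover have "hlength \<gamma> = integral {0..1::real} (\<lambda>s. v - u)"
  proof -
    have "norm (vector_derivative \<gamma> (at s)) / snd (\<gamma> s) = v - u" for s
    proof -
      have "norm (vector_derivative \<gamma> (at s)) / snd (\<gamma> s)
          = (v - u) * (norm (D (u + (v - u) * s)) / snd (null_line N M (u + (v - u) * s)))"
        using uv unfolding vector_derivative_at[OF d\<gamma>] by (simp add: \<gamma>_def)
      then show ?thesis by (simp only: D(3) mult_1_right)
    qed
    then show ?thesis by (simp only: hlength_def)
  qed
  moreover have "pathstart \<gamma> = null_line N M u" "pathfinish \<gamma> = null_line N M v"
    by (simp_all add: pathstart_def pathfinish_def \<gamma>_def)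
  ultimately show "v - u \<in> {hlength \<gamma> | \<gamma>. \<gamma> C1_differentiable_on {0..1} \<and> path_image \<gamma> \<subseteq> H3
        \<and> pathstart \<gamma> = null_line N M u \<and> pathfinish \<gamma> = null_line N M v}"
    unfolding mem_Collect_eq by (intro exI[of _ \<gamma>] conjI) (use uv in simp_all)
next
  fix L assume "L \<in> {hlength \<gamma> | \<gamma>. \<gamma> C1_differentiable_on {0..1} \<and> path_image \<gamma> \<subseteq> H3
        \<and> pathstart \<gamma> = null_line N M u \<and> pathfinish \<gamma> = null_line N M v}"
  then obtain \<gamma> where \<gamma>: "\<gamma> C1_differentiable_on {0..1}" "path_image \<gamma> \<subseteq> H3" "L = hlength \<gamma>"
      "pathstart \<gamma> = null_line N M u" "pathfinish \<gamma> = null_line N M v"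
    unfolding mem_Collect_eq by (elim exE conjE)
  have m: "ln (mink (boost N M s) M) = - s - ln 2" for s
  proof -
    have "mink (boost N M s) M = exp (- s) / 2"
      using fr by (simp add: boost_def null_frame_def)
    then show ?thesis by (simp only: ln_div) simp
  qed
  have "\<bar>ln (mink (boost N M v) M) - ln (mink (boost N M u) M)\<bar> \<le> L"
    using busemann_le_hlength[OF \<gamma>(1,2), of M] fr unfolding \<gamma>(3,4,5)
    by (simp add: unit_vec_null_line null_frame_def \<gamma>)
  then show "v - u \<le> L" using uv by (simp add: m)
qed

text \<open>
  Two distinct points lie on a common null line, where the distance is the difference of the parameters.
\<close>

lemma mink_unit_vec_eq_cosh_hdist:
  assumes "x \<in> H3" "y \<in> H3"
  shows "mink (unit_vec x) (unit_vec y) = cosh (hdist x y)" "hdist x y \<ge> 0"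
proof -
  have *: "mink (unit_vec x) (unit_vec y) = cosh (hdist x y) \<and> hdist x y \<ge> 0 \<and> hdist x x = 0"
    if xy: "x \<in> H3" "y \<in> H3" "x \<noteq> y" for x y
  proof -
    obtain N M d where fr: "null_frame N M" and d: "d > 0" "unit_vec x = boost N M 0" "unit_vec y = boost N M d"
      using null_frame_through[of "unit_vec x" "unit_vec y"] xy
      by (metis unit_vec_future mink_unit_vec mink_gt_1 unit_vec_inject)
    have e: "x = null_line N M 0" "y = null_line N M d"
      unfolding null_line_def d(2,3)[symmetric] using xy by (simp_all add: hs_point_unit_vec)
    have "hdist x y = d" "hdist x x = 0"
      unfolding e using hdist_null_line[OF fr] d by simp_all
    with d fr show ?thesis by (simp add: mink_boost)
  qed
  have "mink (unit_vec x) (unit_vec y) = cosh (hdist x y) \<and> hdist x y \<ge> 0"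
  proof (cases "x = y")
    case True
    \<comment> \<open>Any second point will do: the line through it shows that the distance from \<open>x\<close> to itself is 0.\<close>
    have "(fst x, 2 * snd x) \<in> H3" "x \<noteq> (fst x, 2 * snd x)"
      using assms by (auto simp: H3_def prod_eq_iff)
    from *[OF assms(1) this] show ?thesis
      using True assms by (simp add: mink_unit_vec)
  qed (use * assms in auto)
  then show "mink (unit_vec x) (unit_vec y) = cosh (hdist x y)" "hdist x y \<ge> 0" by auto
qed

section \<open>Geodesic lines and their end points\<close>

lemma geodesic_null_line:
  assumes "null_frame N M"
  shows "geodesic_line (null_line N M)"
proof -
  have "hdist (null_line N M s) (null_line N M s') = \<bar>s - s'\<bar>" for s s'
  proof -
    have "cosh (hdist (null_line N M s) (null_line N M s')) = mink (boost N M s) (boost N M s')"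
      using mink_unit_vec_eq_cosh_hdist(1)[OF null_line_H3[OF assms] null_line_H3[OF assms]]
      by (simp only: unit_vec_null_line[OF assms])
    also have "\<dots> = cosh (s - s')"
      by (rule mink_boost[OF assms])
    finally have "\<bar>hdist (null_line N M s) (null_line N M s')\<bar> = \<bar>s - s'\<bar>"
      by (simp only: cosh_real_eq_iff)
    then show ?thesis
      using mink_unit_vec_eq_cosh_hdist(2)[OF null_line_H3[OF assms] null_line_H3[OF assms]] by simp
  qed
  then show ?thesis
    using assms by (auto simp: geodesic_line_def null_line_H3)
qed

text \<open>
  The frame is fixed by the points at times 0 and 1.  The products of \<open>unit_vec (\<gamma> s)\<close> with these two
  points are \<open>cosh s\<close> and \<open>cosh (s - 1)\<close>; they determine its products with \<open>N\<close> and \<open>M\<close>, and hence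
  its product with \<open>boost N M s\<close>, which turns out to be 1.
\<close>

lemma geodesic_line_imp_null_line:
  assumes "geodesic_line \<gamma>"
  obtains N M where "null_frame N M" "\<gamma> = null_line N M"
proof -
  have H: "\<gamma> s \<in> H3" and d: "hdist (\<gamma> s) (\<gamma> s') = \<bar>s - s'\<bar>" for s s'
    using assms by (auto simp: geodesic_line_def)
  define X where "X s = unit_vec (\<gamma> s)" for s
  have X: "X s \<in> future" "mink (X s) (X s') = cosh (s - s')" for s s'
    using H by (simp_all add: X_def unit_vec_future mink_unit_vec_eq_cosh_hdist d)
  have "mink (X 0) (X 1) > 1"
    using cosh_real_strict_mono[of 0 1] by (simp add: X)
  then obtain N M d where fr: "null_frame N M" and d: "d > 0" and X01: "X 0 = boost N M 0" "X 1 = boost N M d"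
    using null_frame_through[of "X 0" "X 1"] X by (metis cosh_0 diff_self)
  have "cosh d = cosh (1 :: real)"
    using X(2)[of 0 1] mink_boost[OF fr, of 0 d] X01 by simp
  then have d1: "d = 1" using d by simp
  have "boost N M s = X s" for s
  proof (rule mink_eq_1_imp_eq)
    define x where "x = mink (X s) N"
    define y where "y = mink (X s) M"
    define E where "E = exp s"
    define e where "e = exp (1 :: real)"
    have E: "E > 0" "e > 1" "exp (- s) = 1 / E" "exp (s - 1) = E / e" "exp (1 - s) = e / E" "exp (- 1) = 1 / e"
      by (simp_all add: E_def e_def exp_diff exp_minus field_simps)
    have 1: "x + y = (E + 1 / E) / 2"
      using X(2)[of s 0] X01(1) E by (simp add: boost_def cosh_def x_def y_def E_def[symmetric] field_simps)
    have "x / e + e * y = (E / e + e / E) / 2"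
      using X(2)[of s 1] X01(2) E
      by (simp add: boost_def cosh_def x_def y_def e_def[symmetric] d1)
    then have "e * (x / e + e * y) = e * ((E / e + e / E) / 2)" by simp
    then have 2: "x + e\<^sup>2 * y = (E + e\<^sup>2 / E) / 2"
      using E(1,2) by (simp add: distrib_left power2_eq_square add_divide_distrib)
    have "(e\<^sup>2 - 1) * y = (e\<^sup>2 - 1) * (1 / (2 * E))"
      using 1 2 E(1) by (simp add: field_simps)
    moreover have "e\<^sup>2 - 1 \<noteq> 0"
      using E(2) by (auto simp: power2_eq_1_iff)
    ultimately have y: "y = 1 / (2 * E)"
      by (simp only: mult_cancel_left simp_thms)
    then have x: "x = E / 2" using 1 E(1) by (simp add: field_simps)
    have "mink (X s) (boost N M s) = 1 / E * x + E * y"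
      by (simp add: boost_def x_def y_def E E_def[symmetric])
    then show "mink (X s) (boost N M s) = 1"
      using x y E(1) by simp
  qed (use X fr in \<open>simp_all add: boost_unit\<close>)
  then have "\<gamma> = null_line N M"
    using H by (auto simp: null_line_def X_def hs_point_unit_vec)
  with fr show thesis by (rule that)
qed

text \<open>
  After division by \<open>exp s\<close>, the boost tends to \<open>M\<close>.
\<close>

lemma tends_to_ideal_null_line_at_top:
  assumes fr: "null_frame N M" and q: "represents M q"
  shows "tends_to_ideal (null_line N M) at_top q"
proof -
  obtain r where r: "r > 0" "M = r *\<^sub>R coords q" and cl: "q \<in> closed_H3"
    using q by (auto simp: represents_def)
  have null: "mink (coords q) (coords q) = 0"
    using fr r by (simp add: null_frame_def)
  obtain a b c where N: "N = (a, b, c)" by (cases N) auto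
  show ?thesis
  proof (cases q)
    case (Point z t)
    with null cl show ?thesis by (simp add: mink_self)
  next
    case (Ideal \<beta>)
    define \<epsilon> :: "real \<Rightarrow> real" where "\<epsilon> s = exp (- s)" for s
    have eps: "(\<epsilon> \<longlongrightarrow> 0) at_top"
      unfolding \<epsilon>_def by (intro filterlim_compose[OF exp_at_bot] filterlim_uminus_at_bot_at_top)
    have eq: "null_line N M s = (1 / ((\<epsilon> s)\<^sup>2 * a + r)) *\<^sub>R ((\<epsilon> s)\<^sup>2 *\<^sub>R cnj b + r *\<^sub>R \<beta>, \<epsilon> s)" for s
    proof -
      have e: "\<epsilon> s > 0" "exp s = 1 / \<epsilon> s" "exp (- s) = \<epsilon> s" by (simp_all add: \<epsilon>_def exp_minus field_simps)
      have p: "\<epsilon> s * a + r / \<epsilon> s = ((\<epsilon> s)\<^sup>2 * a + r) / \<epsilon> s" 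
        using e by (simp add: field_simps power2_eq_square)
      have "hs_point (boost N M s) = (1 / (\<epsilon> s * a + r / \<epsilon> s)) *\<^sub>R (\<epsilon> s *\<^sub>R cnj b + (r / \<epsilon> s) *\<^sub>R \<beta>, 1)"
        by (simp add: hs_point_def boost_def N r Ideal e)
      also have "\<dots> = (1 / ((\<epsilon> s)\<^sup>2 * a + r)) *\<^sub>R (\<epsilon> s *\<^sub>R (\<epsilon> s *\<^sub>R cnj b + (r / \<epsilon> s) *\<^sub>R \<beta>, 1))"
        unfolding p by simp
      also have "\<epsilon> s *\<^sub>R (\<epsilon> s *\<^sub>R cnj b + (r / \<epsilon> s) *\<^sub>R \<beta>, 1) = ((\<epsilon> s)\<^sup>2 *\<^sub>R cnj b + r *\<^sub>R \<beta>, \<epsilon> s)"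
        using e by (simp add: scaleR_add_right power2_eq_square)
      finally show ?thesis by (simp add: null_line_def)
    qed
    have "(null_line N M \<longlongrightarrow> (1 / (0\<^sup>2 * a + r)) *\<^sub>R (0\<^sup>2 *\<^sub>R cnj b + r *\<^sub>R \<beta>, 0)) at_top"
      unfolding eq[abs_def] using r by (intro tendsto_intros eps) auto
    then show ?thesis using r by (simp add: Ideal)
  next
    case Infty
    have "a > 0" using fst_boost_pos[OF fr, of 0] r by (simp add: boost_def N Infty)
    have "norm (null_line N M s) \<ge> exp s / a" for s
    proof -
      have "snd (null_line N M s) = exp s / a"
        by (simp add: null_line_def hs_point_def boost_def N r Infty exp_minus field_simps)
      moreover have "norm (snd (null_line N M s)) \<le> norm (null_line N M s)"
        using norm_snd_le[of "snd (null_line N M s)" "fst (null_line N M s)"] by simp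
      ultimately show ?thesis
        using \<open>a > 0\<close> by simp
    qed
    moreover have "filterlim (\<lambda>s. exp s / a) at_top at_top"
      using \<open>a > 0\<close> filterlim_tendsto_pos_mult_at_top[OF tendsto_const _ exp_at_top, of "1 / a"]
      by (simp add: field_simps)
    ultimately have "filterlim (\<lambda>s. norm (null_line N M s)) at_top at_top"
      by (intro filterlim_at_top_mono[where g = "\<lambda>s. norm (null_line N M s)"]) auto
    then show ?thesis
      by (simp add: Infty filterlim_at_infinity_conv_norm_at_top)
  qed
qed

lemma tends_to_ideal_reverse:
  "tends_to_ideal \<gamma> at_top q \<Longrightarrow> tends_to_ideal (\<lambda>s. \<gamma> (- s)) at_bot q"
  by (cases q) (auto intro: filterlim_compose[OF _ filterlim_uminus_at_top_at_bot])

lemma boost_reverse: "boost N M s = boost M N (- s)"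
  by (simp add: boost_def add.commute)

lemma tends_to_ideal_null_line_at_bot:
  assumes "null_frame N M" "represents N q"
  shows "tends_to_ideal (null_line N M) at_bot q"
proof -
  have "null_line N M = (\<lambda>s. null_line M N (- s))"
    unfolding null_line_def by (auto simp: boost_reverse[of N M])
  then show ?thesis
    using tends_to_ideal_reverse[OF tends_to_ideal_null_line_at_top, of M N q] assms null_frame_commute by metis
qed

lemma tends_to_ideal_unique:
  assumes "tends_to_ideal \<gamma> F p" "tends_to_ideal \<gamma> F q" "F \<noteq> bot"
  shows "p = q"
  using assms tendsto_unique[of F \<gamma>] not_tendsto_and_filterlim_at_infinity[of F \<gamma>]
  by (cases p; cases q; auto)

text \<open>
  Homogeneous coordinates of the point at time \<open>u\<close>, with the end points at \<open>\<plusminus>\<infinity>\<close> included.  The pair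
  \<open>(weight_minus u, weight_plus u)\<close> turns monotonically from \<open>(1, 0)\<close> to \<open>(0, 1)\<close>, which
  treats finite and infinite times alike.
\<close>

fun weight_minus :: "ereal \<Rightarrow> real" where
  "weight_minus (ereal s) = exp (- s)"
| "weight_minus PInfty = 0"
| "weight_minus MInfty = 1"

fun weight_plus :: "ereal \<Rightarrow> real" where
  "weight_plus (ereal s) = exp s"
| "weight_plus PInfty = 1"
| "weight_plus MInfty = 0"

definition boost_at :: "herm \<Rightarrow> herm \<Rightarrow> ereal \<Rightarrow> herm" where
  "boost_at N M u = weight_minus u *\<^sub>R N + weight_plus u *\<^sub>R M"

lemma weight_infty [simp]:
  "weight_minus \<infinity> = 0" "weight_minus (- \<infinity>) = 1" "weight_plus \<infinity> = 1" "weight_plus (- \<infinity>) = 0"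
  by (simp_all flip: PInfty_eq_infinity MInfty_eq_minfinity)

lemma line_at_infty [simp]:
  "line_at \<gamma> \<infinity> p \<longleftrightarrow> tends_to_ideal \<gamma> at_top p"
  "line_at \<gamma> (- \<infinity>) p \<longleftrightarrow> tends_to_ideal \<gamma> at_bot p"
  by (simp_all flip: PInfty_eq_infinity MInfty_eq_minfinity)

lemma weight_le_iff: "weight_minus v * weight_plus u \<le> weight_minus u * weight_plus v \<longleftrightarrow> u \<le> v"
  by (cases u; cases v) (auto simp flip: exp_add)

lemma ex_weights:
  assumes "x \<ge> 0" "y \<ge> 0" "x \<noteq> 0 \<or> y \<noteq> 0"
  obtains r w where "r > 0" "x = r * weight_minus w" "y = r * weight_plus w"
proof -
  consider "x = 0" "y > 0" | "x > 0" "y = 0" | "x > 0" "y > 0"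
    using assms by fastforce
  then show thesis
  proof cases
    case 1
    then show thesis by (intro that[of y PInfty]) auto
  next
    case 2
    then show thesis by (intro that[of x MInfty]) auto
  next
    case 3
    define w where "w = ln (y / x) / 2"
    have "exp w = sqrt (y / x)" 
      using 3 by (simp add: w_def powr_def flip: powr_half_sqrt)
    then have "exp w = sqrt y / sqrt x" "exp (- w) = sqrt x / sqrt y"
      using 3 by (auto simp: real_sqrt_divide exp_minus)
    then show thesis
      using 3 by (intro that[of "sqrt x * sqrt y" "ereal w"]) auto
  qed
qed

text \<open>
  Every point of a null line, ideal end points included, is the zero of the combination of \<open>N\<close> and
  \<open>M\<close> that belongs to its time.
\<close>

lemma line_at_null_line:
  assumes fr: "null_frame N M"
  shows "line_at (null_line N M) u p \<longleftrightarrow> represents (boost_at N M u) p"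
proof (cases u)
  case (real s)
  have "represents (boost N M s) (Point (fst (null_line N M s)) (snd (null_line N M s)))"
    using represents_unit_vec[OF null_line_H3[OF fr, of s]] by (simp add: unit_vec_null_line[OF fr])
  then show ?thesis
    by (auto simp: real boost_at_def simp flip: boost_def intro: represents_unique)
next
  case PInf
  obtain q where q: "represents M q" using fr ex_represents unfolding null_frame_def by blast
  from tends_to_ideal_null_line_at_top[OF fr] q show ?thesis
    by (auto simp: PInf boost_at_def
        dest: tends_to_ideal_unique[of _ at_top, OF _ _ trivial_limit_at_top_linorder] represents_unique)
next
  case MInf
  obtain q where q: "represents N q" using fr ex_represents unfolding null_frame_def by blast
  from tends_to_ideal_null_line_at_bot[OF fr] q show ?thesis
    by (auto simp: MInf boost_at_def
        dest: tends_to_ideal_unique[of _ at_bot, OF _ _ trivial_limit_at_bot_linorder] represents_unique)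
qed

section \<open>Segments are nonnegative combinations\<close>

text \<open>
  Cramer's rule: the coefficients are quotients of \<open>2 \<times> 2\<close> determinants of weights, whose signs are
  the order of the times by \<open>weight_le_iff\<close>.
\<close>

lemma boost_at_between:
  assumes "u \<le> w" "w \<le> v"
  obtains l m where "l \<ge> 0" "m \<ge> 0" "boost_at N M w = l *\<^sub>R boost_at N M u + m *\<^sub>R boost_at N M v"
proof (cases "u = v")
  case True
  then show thesis using assms by (intro that[of 1 0]) auto
next
  case False
  define \<Delta> where "\<Delta> = weight_minus u * weight_plus v - weight_minus v * weight_plus u"
  have \<Delta>: "\<Delta> > 0"
    using weight_le_iff[of u v] assms False unfolding \<Delta>_def by (simp add: not_le[symmetric])
  define l where "l = (weight_minus w * weight_plus v - weight_minus v * weight_plus w) / \<Delta>"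
  define m where "m = (weight_minus u * weight_plus w - weight_minus w * weight_plus u) / \<Delta>"
  have "l \<ge> 0" "m \<ge> 0"
    using weight_le_iff assms \<Delta> by (auto simp: l_def m_def)
  moreover have "weight_minus w = l * weight_minus u + m * weight_minus v"
    using \<Delta> by (simp add: l_def m_def field_simps) (simp add: \<Delta>_def algebra_simps)
  moreover have "weight_plus w = l * weight_plus u + m * weight_plus v"
    using \<Delta> by (simp add: l_def m_def field_simps) (simp add: \<Delta>_def algebra_simps)
  ultimately show thesis
    by (intro that[of l m]) (simp_all add: boost_at_def algebra_simps)
qed

lemma combination_boost_at:
  assumes "u < v" "l \<ge> 0" "m \<ge> 0" "l \<noteq> 0 \<or> m \<noteq> 0"
  obtains r w where "r > 0" "u \<le> w" "w \<le> v"
    "l *\<^sub>R boost_at N M u + m *\<^sub>R boost_at N M v = r *\<^sub>R boost_at N M w"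
proof -
  define \<Delta> where "\<Delta> = weight_minus u * weight_plus v - weight_minus v * weight_plus u"
  have \<Delta>: "\<Delta> > 0"
    using weight_le_iff[of u v] assms unfolding \<Delta>_def by (simp add: not_le[symmetric])
  define x where "x = l * weight_minus u + m * weight_minus v"
  define y where "y = l * weight_plus u + m * weight_plus v"
  have \<Delta>u: "weight_minus u * y - x * weight_plus u = m * \<Delta>"
    and \<Delta>v: "x * weight_plus v - weight_minus v * y = l * \<Delta>"
    by (simp_all add: x_def y_def \<Delta>_def algebra_simps)
  have nonneg: "weight_minus s \<ge> 0" "weight_plus s \<ge> 0" for s by (cases s; simp)+
  have "x \<ge> 0" "y \<ge> 0" using assms nonneg by (auto simp: x_def y_def)
  moreover have "x \<noteq> 0 \<or> y \<noteq> 0" using \<Delta>u \<Delta>v \<Delta> assms by auto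
  ultimately obtain r w where r: "r > 0" and w: "x = r * weight_minus w" "y = r * weight_plus w"
    by (rule ex_weights)
  have "r * (weight_minus u * weight_plus w - weight_minus w * weight_plus u) = m * \<Delta>"
    using \<Delta>u w by (simp add: algebra_simps)
  with r \<Delta> assms have "u \<le> w"
    by (metis diff_ge_0_iff_ge less_le mult_nonneg_nonneg weight_le_iff zero_le_mult_iff not_less)
  have "r * (weight_minus w * weight_plus v - weight_minus v * weight_plus w) = l * \<Delta>"
    using \<Delta>v w by (simp add: algebra_simps)
  with r \<Delta> assms have "w \<le> v"
    by (metis diff_ge_0_iff_ge less_le mult_nonneg_nonneg weight_le_iff zero_le_mult_iff not_less)
  have "l *\<^sub>R boost_at N M u + m *\<^sub>R boost_at N M v = x *\<^sub>R N + y *\<^sub>R M"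
    by (simp add: boost_at_def x_def y_def algebra_simps)
  also have "\<dots> = r *\<^sub>R boost_at N M w"
    by (simp add: boost_at_def w algebra_simps)
  finally show thesis using that r \<open>u \<le> w\<close> \<open>w \<le> v\<close> by blast
qed

lemma closed_H3_cases:
  assumes "p \<in> closed_H3"
  obtains (interior) P where "P \<in> future" "mink P P = 1" "represents P p"
    | (ideal) "mink (coords p) (coords p) = 0"
proof (cases p)
  case (Point z t)
  then have "(z, t) \<in> H3" using assms by (simp add: H3_def)
  from interior[OF unit_vec_future[OF this] mink_unit_vec[OF this]] represents_unit_vec[OF this]
  show thesis by (simp add: Point)
qed (auto intro!: ideal simp: mink_self)

lemma mink_coords_ideal_pos:
  assumes "p \<in> closed_H3" "q \<in> closed_H3" "p \<noteq> q"
    and "mink (coords p) (coords p) = 0" "mink (coords q) (coords q) = 0"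
  shows "mink (coords p) (coords q) > 0"
proof -
  have sq: "mink (coords (Ideal \<alpha>)) (coords (Ideal \<beta>)) = (cmod (\<alpha> - \<beta>))\<^sup>2 / 2" for \<alpha> \<beta>
    by (simp add: mink_def cmod_power2 inner_complex_def) (simp add: field_simps power2_eq_square)
  have "mink (coords (Ideal \<alpha>)) (coords (Ideal \<beta>)) > 0" if "\<alpha> \<noteq> \<beta>" for \<alpha> \<beta>
    unfolding sq using that by simp
  moreover have "mink (coords (Ideal \<alpha>)) (coords Infty) > 0" "mink (coords Infty) (coords (Ideal \<alpha>)) > 0" for \<alpha>
    by (simp_all add: mink_def)
  moreover have "mink (coords (Point z t)) (coords (Point z t)) = t\<^sup>2" for z t
    by (simp add: mink_self)
  ultimately show ?thesis
    using assms by (cases p; cases q) (auto simp del: coords.simps)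
qed

text \<open>
  The plane spanned by a timelike \<open>P\<close> and a lightlike \<open>Q\<close> contains one further lightlike ray,
  that of \<open>P - r Q\<close> for the right \<open>r\<close>.
\<close>

lemma null_frame_ray:
  assumes "P \<in> future" "mink P P = 1" "Q \<in> future" "mink Q Q = 0"
  obtains N r where "r > 0" "null_frame N (r *\<^sub>R Q)" "P = boost N (r *\<^sub>R Q) 0"
proof -
  have m: "mink P Q > 0" using mink_pos[of P Q] assms by simp
  define r where "r = 1 / (2 * mink P Q)"
  define N where "N = P - r *\<^sub>R Q"
  have r: "r > 0" "mink P (r *\<^sub>R Q) = 1 / 2" "mink (r *\<^sub>R Q) P = 1 / 2" "mink (r *\<^sub>R Q) (r *\<^sub>R Q) = 0"
    using m assms by (simp_all add: r_def mink_commute[of Q P])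
  have "mink N N = 0" "mink P N = 1 / 2" "mink N (r *\<^sub>R Q) = 1 / 2"
    unfolding N_def mink_simps(3,4) using r assms by simp_all
  moreover from this have "N \<in> future"
    using assms(1) by (intro future_if_mink_pos[OF assms(1)]) simp_all
  ultimately have "null_frame N (r *\<^sub>R Q)"
    using r assms by (simp add: null_frame_def future_scaleR del: mink_simps)
  with r(1) show thesis
    by (rule that) (simp add: boost_def N_def)
qed

text \<open>
  Two distinct points, ideal or not, span a plane that meets the cone in two lightlike rays; each
  combination of interior and ideal points gives these rays by a different formula.
\<close>

lemma null_line_through:
  assumes "p \<in> closed_H3" "q \<in> closed_H3" "p \<noteq> q"
  obtains N M u v where "null_frame N M" "u < v"
    "represents (boost_at N M u) p" "represents (boost_at N M v) q"
proof -
  have b: "boost_at N M (ereal s) = boost N M s" "boost_at N M \<infinity> = M" "boost_at N M (- \<infinity>) = N" for N M s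
    by (simp_all add: boost_at_def boost_def)
  show thesis
    using assms(1)
  proof (cases rule: closed_H3_cases)
    case P: (interior P)
    show thesis using assms(2)
    proof (cases rule: closed_H3_cases)
      case Q: (interior Q)
      have "P \<noteq> Q" using P Q assms(3) represents_unique by blast
      with P Q have "mink P Q > 1" by (intro mink_gt_1) auto
      with P Q obtain N M d where "null_frame N M" "d > 0" "P = boost N M 0" "Q = boost N M d"
        using null_frame_through by metis
      with P Q show thesis by (intro that[of N M "ereal 0" "ereal d"]) (simp_all add: b)
    next
      case ideal
      with P coords_future[OF assms(2)] obtain N r where "r > 0" "null_frame N (r *\<^sub>R coords q)" "P = boost N (r *\<^sub>R coords q) 0"
        using null_frame_ray by metis
      with P assms show thesis
        by (intro that[of N "r *\<^sub>R coords q" "ereal 0" "\<infinity>"]) (auto simp: b represents_def)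
    qed
  next
    case p: ideal
    show thesis using assms(2)
    proof (cases rule: closed_H3_cases)
      case Q: (interior Q)
      with p coords_future[OF assms(1)] obtain N r where "r > 0" "null_frame N (r *\<^sub>R coords p)" "Q = boost N (r *\<^sub>R coords p) 0"
        using null_frame_ray by metis
      with Q assms show thesis
        by (intro that[of "r *\<^sub>R coords p" N "- \<infinity>" "ereal 0"])
          (auto simp: b null_frame_commute[of N] boost_reverse[of N] represents_def)
    next
      case q: ideal
      define m where "m = mink (coords p) (coords q)"
      have "m > 0"
        using p q assms unfolding m_def by (intro mink_coords_ideal_pos)
      then have "null_frame (coords p) ((1 / (2 * m)) *\<^sub>R coords q)"
        using p q assms by (simp add: null_frame_def coords_future future_scaleR m_def)
      with assms \<open>m > 0\<close> show thesis
        by (intro that[of "coords p" "(1 / (2 * m)) *\<^sub>R coords q" "- \<infinity>" "\<infinity>"])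
          (auto simp: b represents_def intro: exI[of _ 1] exI[of _ "1 / (2 * m)"])
    qed
  qed
qed

lemma hsegment_imp_combination:
  assumes "x \<in> hsegment p q"
  obtains l m where "l \<ge> 0" "m \<ge> 0" "represents (l *\<^sub>R coords p + m *\<^sub>R coords q) x"
proof -
  obtain \<gamma> u v w where geo: "geodesic_line \<gamma>"
      and *: "line_at \<gamma> u p" "line_at \<gamma> v q" "u \<le> w" "w \<le> v" "line_at \<gamma> w x"
    using assms unfolding hsegment_def by blast
  obtain N M where fr: "null_frame N M" and \<gamma>: "\<gamma> = null_line N M"
    using geodesic_line_imp_null_line[OF geo] .
  have rep: "represents (boost_at N M u) p" "represents (boost_at N M v) q" "represents (boost_at N M w) x"
    using *(1,2,5) unfolding \<gamma> line_at_null_line[OF fr] .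
  obtain r where r: "r > 0" "boost_at N M u = r *\<^sub>R coords p"
    using rep(1) unfolding represents_def by blast
  obtain s where s: "s > 0" "boost_at N M v = s *\<^sub>R coords q"
    using rep(2) unfolding represents_def by blast
  obtain l m where lm: "l \<ge> 0" "m \<ge> 0" "boost_at N M w = l *\<^sub>R boost_at N M u + m *\<^sub>R boost_at N M v"
    using boost_at_between[OF *(3,4)] .
  have "represents ((l * r) *\<^sub>R coords p + (m * s) *\<^sub>R coords q) x"
    using rep(3) unfolding lm(3) r(2) s(2) by simp
  then show thesis
    using lm(1,2) r(1) s(1) by (intro that[of "l * r" "m * s"]) simp_all
qed

lemma combination_imp_hsegment:
  assumes "p \<in> closed_H3" "q \<in> closed_H3" "p \<noteq> q" "l \<ge> 0" "m \<ge> 0"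
    and x: "represents (l *\<^sub>R coords p + m *\<^sub>R coords q) x"
  shows "x \<in> hsegment p q"
proof -
  obtain N M u v where fr: "null_frame N M" and uv: "u < v"
    and pq: "represents (boost_at N M u) p" "represents (boost_at N M v) q"
    using null_line_through[OF assms(1-3)] .
  obtain r where r: "r > 0" "boost_at N M u = r *\<^sub>R coords p"
    using pq(1) unfolding represents_def by blast
  obtain s where s: "s > 0" "boost_at N M v = s *\<^sub>R coords q"
    using pq(2) unfolding represents_def by blast
  note rs = r(1) s(1) r(2) s(2)
  have "l \<noteq> 0 \<or> m \<noteq> 0"
    using represents_future[OF x] by (auto simp: future_def)
  then have lm: "l / r \<ge> 0" "m / s \<ge> 0" "l / r \<noteq> 0 \<or> m / s \<noteq> 0"
    using rs assms by auto
  obtain k w where k: "k > 0" and w: "u \<le> w" "w \<le> v"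
    "(l / r) *\<^sub>R boost_at N M u + (m / s) *\<^sub>R boost_at N M v = k *\<^sub>R boost_at N M w"
    by (rule combination_boost_at[OF uv lm])
  have "k *\<^sub>R boost_at N M w = l *\<^sub>R coords p + m *\<^sub>R coords q"
    unfolding w(3)[symmetric] using rs by simp
  then have "boost_at N M w = (1 / k) *\<^sub>R (l *\<^sub>R coords p + m *\<^sub>R coords q)"
    using k by (simp flip: \<open>k *\<^sub>R boost_at N M w = _\<close>)
  with x k have "represents (boost_at N M w) x"
    by (simp add: represents_scaleR)
  then show ?thesis
    using geodesic_null_line[OF fr] line_at_null_line[OF fr] pq w(1,2) unfolding hsegment_def by blast
qed

section \<open>Zeros of combinations and the convex hull\<close>

lemma sum_future:
  assumes "finite I" "\<And>i. i \<in> I \<Longrightarrow> \<omega> i \<in> closed_H3" "\<And>i. i \<in> I \<Longrightarrow> l i \<ge> 0"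
  shows "(\<Sum>i\<in>I. l i *\<^sub>R coords (\<omega> i)) \<noteq> 0 \<Longrightarrow> (\<Sum>i\<in>I. l i *\<^sub>R coords (\<omega> i)) \<in> future"
  using assms
proof (induction I)
  case (insert i I)
  let ?X = "\<Sum>i\<in>I. l i *\<^sub>R coords (\<omega> i)"
  have X: "?X = 0 \<or> ?X \<in> future" using insert.IH insert.prems by auto
  have i: "l i *\<^sub>R coords (\<omega> i) = 0 \<or> l i *\<^sub>R coords (\<omega> i) \<in> future"
    using insert.prems coords_future[of "\<omega> i"] by (auto simp: less_le intro!: future_scaleR)
  from X i insert.hyps insert.prems(1) show ?case
    by (auto intro: future_add)
qed simp

lemma sum_future_if_pos:
  assumes "finite I" "\<And>i. i \<in> I \<Longrightarrow> \<omega> i \<in> closed_H3" "\<And>i. i \<in> I \<Longrightarrow> l i \<ge> 0" "j \<in> I" "l j > 0"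
  shows "(\<Sum>i\<in>I. l i *\<^sub>R coords (\<omega> i)) \<in> future"
proof -
  let ?X = "\<Sum>i\<in>I - {j}. l i *\<^sub>R coords (\<omega> i)"
  have "?X = 0 \<or> ?X \<in> future"
    using assms sum_future[of "I - {j}" \<omega> l] by auto
  moreover have "l j *\<^sub>R coords (\<omega> j) \<in> future"
    using assms by (intro future_scaleR coords_future) auto
  ultimately show ?thesis
    using assms by (auto simp: sum.remove intro: future_add)
qed

text \<open>
  Adding a summand to a combination with zero \<open>q\<close> moves the zero into the segment from \<open>q\<close> to the new
  point.  If both coincide, the zero stays, and no geodesic line is involved.
\<close>

lemma represents_combination_in_hconvex:
  assumes C: "hconvex C" and I: "finite I" "\<And>i. i \<in> I \<Longrightarrow> \<omega> i \<in> C" "\<And>i. i \<in> I \<Longrightarrow> l i \<ge> 0"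
    and p: "represents (\<Sum>i\<in>I. l i *\<^sub>R coords (\<omega> i)) p"
  shows "p \<in> C"
  using I p
proof (induction I arbitrary: p)
  case empty
  then show ?case by (auto simp: represents_def coords_nonzero)
next
  case (insert i I)
  let ?X = "\<Sum>i\<in>I. l i *\<^sub>R coords (\<omega> i)"
  have cl: "C \<subseteq> closed_H3" and seg: "\<And>p q. p \<in> C \<Longrightarrow> q \<in> C \<Longrightarrow> hsegment p q \<subseteq> C"
    using C by (auto simp: hconvex_def)
  have p: "represents (l i *\<^sub>R coords (\<omega> i) + ?X) p"
    using insert.prems insert.hyps by simp
  have i: "\<omega> i \<in> C" "\<omega> i \<in> closed_H3" "l i \<ge> 0" using insert.prems cl by auto
  show ?case
  proof (cases "?X = 0")
    case True
    with p have "l i \<noteq> 0" using represents_future[OF p] by (auto simp: future_def)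
    with i have "represents (l i *\<^sub>R coords (\<omega> i)) (\<omega> i)"
      by (intro represents_scaleR represents_coords) auto
    moreover have "represents (l i *\<^sub>R coords (\<omega> i)) p" using p True by simp
    ultimately show ?thesis using represents_unique i(1) by blast
  next
    case False
    have "?X \<in> future"
      using insert.prems cl False insert.hyps(1) by (intro sum_future) auto
    then obtain q where q: "represents ?X q" using ex_represents by blast
    have "q \<in> C" using insert.IH[OF _ _ q] insert.prems by auto
    obtain r where r: "r > 0" "?X = r *\<^sub>R coords q" using q unfolding represents_def by blast
    show ?thesis
    proof (cases "q = \<omega> i")
      case True
      have "represents ((l i + r) *\<^sub>R coords (\<omega> i)) p"
        using p unfolding r(2) True by (simp add: scaleR_add_left)
      moreover have "represents ((l i + r) *\<^sub>R coords (\<omega> i)) (\<omega> i)"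
        using r(1) i by (intro represents_scaleR represents_coords) auto
      ultimately show ?thesis using represents_unique i(1) by blast
    next
      case False
      have "p \<in> hsegment q (\<omega> i)"
        using False \<open>q \<in> C\<close> cl i r p
        by (intro combination_imp_hsegment[of q "\<omega> i" r "l i"]) (auto simp: add.commute)
      then show ?thesis using seg \<open>q \<in> C\<close> i by blast
    qed
  qed
qed

text \<open>
  A combination of two combinations is a combination; the total weight is left free here, as only rays matter.
\<close>

lemma hconvex_combinations:
  assumes "finite I" "\<And>i. i \<in> I \<Longrightarrow> \<omega> i \<in> closed_H3"
  shows "hconvex {p. \<exists>l. (\<forall>i\<in>I. l i \<ge> 0) \<and> represents (\<Sum>i\<in>I. l i *\<^sub>R coords (\<omega> i)) p}"
  unfolding hconvex_def
proof (intro conjI ballI subsetI)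
  fix p q x
  assume "p \<in> {p. \<exists>l. (\<forall>i\<in>I. l i \<ge> 0) \<and> represents (\<Sum>i\<in>I. l i *\<^sub>R coords (\<omega> i)) p}"
    and "q \<in> {p. \<exists>l. (\<forall>i\<in>I. l i \<ge> 0) \<and> represents (\<Sum>i\<in>I. l i *\<^sub>R coords (\<omega> i)) p}"
    and x: "x \<in> hsegment p q"
  then obtain k l where k: "\<forall>i\<in>I. k i \<ge> 0" "represents (\<Sum>i\<in>I. k i *\<^sub>R coords (\<omega> i)) p"
      and l: "\<forall>i\<in>I. l i \<ge> 0" "represents (\<Sum>i\<in>I. l i *\<^sub>R coords (\<omega> i)) q"
    by blast
  obtain r where r: "r > 0" "(\<Sum>i\<in>I. k i *\<^sub>R coords (\<omega> i)) = r *\<^sub>R coords p"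
    using k(2) unfolding represents_def by blast
  obtain s where s: "s > 0" "(\<Sum>i\<in>I. l i *\<^sub>R coords (\<omega> i)) = s *\<^sub>R coords q"
    using l(2) unfolding represents_def by blast
  obtain a b where ab: "a \<ge> 0" "b \<ge> 0" "represents (a *\<^sub>R coords p + b *\<^sub>R coords q) x"
    using hsegment_imp_combination[OF x] .
  have "a *\<^sub>R coords p + b *\<^sub>R coords q = (a / r) *\<^sub>R (r *\<^sub>R coords p) + (b / s) *\<^sub>R (s *\<^sub>R coords q)"
    using r(1) s(1) by simp
  also have "\<dots> = (\<Sum>i\<in>I. (a / r * k i + b / s * l i) *\<^sub>R coords (\<omega> i))"
    unfolding r(2)[symmetric] s(2)[symmetric]
    by (simp add: scaleR_sum_right sum.distrib scaleR_add_left)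
  finally have "represents (\<Sum>i\<in>I. (a / r * k i + b / s * l i) *\<^sub>R coords (\<omega> i)) x"
    using ab(3) by simp
  moreover have "\<forall>i\<in>I. a / r * k i + b / s * l i \<ge> 0"
    using ab k(1) l(1) r(1) s(1) by simp
  ultimately show "x \<in> {p. \<exists>l. (\<forall>i\<in>I. l i \<ge> 0) \<and> represents (\<Sum>i\<in>I. l i *\<^sub>R coords (\<omega> i)) p}"
    by (intro CollectI exI[of _ "\<lambda>i. a / r * k i + b / s * l i"] conjI)
qed (auto simp: represents_def)

theorem proposition7:
  fixes n :: nat and \<omega> :: "nat \<Rightarrow> hpoint"
  assumes "\<And>i. i \<in> {1..n} \<Longrightarrow> \<omega> i \<in> closed_H3"
  shows "(\<forall>l. (\<forall>i\<in>{1..n}. l i \<ge> 0) \<and> (\<Sum>i=1..n. l i) = 1 \<longrightarrow> (\<exists>!p. has_zero (combination n \<omega> l) p))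
       \<and> {\<xi> (combination n \<omega> l) | l. (\<forall>i\<in>{1..n}. l i \<ge> 0) \<and> (\<Sum>i=1..n. l i) = 1}
           = hconvex hull (\<omega> ` {1..n})"
proof -
  define X where "X l = (\<Sum>i=1..n. l i *\<^sub>R coords (\<omega> i))" for l
  have comb: "combination n \<omega> l = form_of (X l)" for l
    unfolding X_def by (rule combination_eq)
  have ex: "\<exists>p. represents (X l) p"
    if l: "\<forall>i\<in>{1..n}. l i \<ge> 0" "(\<Sum>i=1..n. l i) = 1" for l :: "nat \<Rightarrow> real"
  proof (rule ex_represents)
    obtain j where j: "j \<in> {1..n}" "l j \<noteq> 0"
      using l(2) by (metis sum.neutral zero_neq_one)
    show "X l \<in> future"
      unfolding X_def
      using l(1) assms j by (intro sum_future_if_pos[of _ _ _ j]) (auto simp: less_le)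
  qed
  have zero: "{\<xi> (combination n \<omega> l) | l. (\<forall>i\<in>{1..n}. l i \<ge> 0) \<and> (\<Sum>i=1..n. l i) = 1}
      = {p. \<exists>l. (\<forall>i\<in>{1..n}. l i \<ge> 0) \<and> represents (X l) p}" (is "?Z = ?R")
  proof (intro equalityI subsetI)
    fix p assume "p \<in> ?Z"
    then obtain l where l: "p = \<xi> (combination n \<omega> l)" "\<forall>i\<in>{1..n}. l i \<ge> 0" "(\<Sum>i=1..n. l i) = 1"
      by blast
    from ex[OF l(2,3)] obtain q where q: "represents (X l) q" ..
    then have "p = q" unfolding l(1) comb by (rule form_zero_eq)
    with q l(2) show "p \<in> ?R" by blast
  next
    fix p assume "p \<in> ?R"
    then obtain l where l: "\<forall>i\<in>{1..n}. l i \<ge> 0" "represents (X l) p" by blast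
    define s where "s = (\<Sum>i=1..n. l i)"
    have "s \<noteq> 0"
    proof
      assume "s = 0"
      then have "\<forall>i\<in>{1..n}. l i = 0"
        using l(1) unfolding s_def by (subst (asm) sum_nonneg_eq_0_iff) auto
      then have "X l = 0" by (simp add: X_def)
      with represents_future[OF l(2)] show False by (simp add: future_def)
    qed
    moreover have "s \<ge> 0" unfolding s_def using l(1) by (intro sum_nonneg) auto
    ultimately have s: "s > 0" by simp
    define k where "k i = l i / s" for i
    \<comment> \<open>Rescaling the weights to total 1 does not change the ray.\<close>
    have "\<forall>i\<in>{1..n}. k i \<ge> 0" "(\<Sum>i=1..n. k i) = 1"
      using l(1) s by (auto simp: k_def s_def simp flip: sum_divide_distrib)
    moreover have "X k = (1 / s) *\<^sub>R X l"
      by (simp add: X_def k_def scaleR_sum_right)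
    then have "represents (X k) p"
      using l(2) s by (simp add: represents_scaleR)
    then have "p = \<xi> (combination n \<omega> k)"
      unfolding comb by (rule form_zero_eq[symmetric])
    ultimately show "p \<in> ?Z" by blast
  qed
  have "?R = hconvex hull (\<omega> ` {1..n})"
  proof (intro equalityI subsetI)
    fix p assume "p \<in> ?R"
    then obtain l where l: "\<forall>i\<in>{1..n}. l i \<ge> 0" "represents (X l) p" by blast
    have "p \<in> C" if C: "hconvex C" "\<omega> ` {1..n} \<subseteq> C" for C
      by (rule represents_combination_in_hconvex[of C "{1..n}" \<omega> l]) (use C l in \<open>auto simp: X_def\<close>)
    then show "p \<in> hconvex hull (\<omega> ` {1..n})"
      by (simp add: hull_def)
  next
    fix p assume "p \<in> hconvex hull (\<omega> ` {1..n})"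
    moreover have "hconvex hull (\<omega> ` {1..n}) \<subseteq> ?R"
    proof (rule hull_minimal)
      show "hconvex ?R"
        unfolding X_def using assms by (intro hconvex_combinations) auto
      show "\<omega> ` {1..n} \<subseteq> ?R"
      proof (intro image_subsetI CollectI)
        fix j assume j: "j \<in> {1..n}"
        have "X (\<lambda>i. if i = j then 1 else 0) = coords (\<omega> j)"
          unfolding X_def using j by (simp add: if_distrib[of "\<lambda>c. c *\<^sub>R _"] sum.delta cong: if_cong)
        with j assms show "\<exists>l. (\<forall>i\<in>{1..n}. l i \<ge> 0) \<and> represents (X l) (\<omega> j)"
          by (intro exI[of _ "\<lambda>i. if i = j then 1 else 0"]) (auto simp: represents_coords)
      qed
    qed
    ultimately show "p \<in> ?R" by blast
  qed
  moreover have "\<exists>!p. has_zero (combination n \<omega> l) p"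
    if "\<forall>i\<in>{1..n}. l i \<ge> 0" "(\<Sum>i=1..n. l i) = 1" for l
    unfolding comb has_zero_iff using ex[OF that] represents_unique by blast
  ultimately show ?thesis
    unfolding zero by blast
qed

end
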